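(* Let $\mathcal Q$ be a $\sigma$-ring and let $f$ be the map with domain $\mathcal M_\sigma(\mathcal Q,\mathfrak R)$ such that $f(\eta)=\mathfrak F\eta$ for every $\eta\in\mathcal M_\sigma(\mathcal Q,\mathfrak R)$. Then $f$ is an isomorphism of ordered monoids from $\mathcal M_\sigma(\mathcal Q,\mathfrak R)$ to $\mathcal M(\mathcal Q,\mathbb R_+)$. We have $f^{-1}(\mu)=[\![\mu]\!]_{\mathfrak R}$ for every $\mu\in\mathcal M(\mathcal Q,\mathbb R_+)$.
   Context: Monoids are Abelian and written additively. An HTM is a monoid with a Hausdorff topology making addition continuous. For a map $f$, $D_f$ denotes its domain. "Countable" includes finite and empty. A ring (of sets) is a nonempty set $\mathcal Q$ of sets such that $A\cup B\in\mathcal Q$ and $A\setminus B\in\mathcal Q$ for all $A,B\in\mathcal Q$. A $\delta$-ring is a ring closed under intersections of nonempty countable families; a $\sigma$-ring is a ring closed under countable unions. For a set of sets $\mathcal K$, $\sigma(\mathcal K)$ is the smallest $\sigma$-ring containing $\mathcal K$ and $\sigma_0(\mathcal K)$ is the set of all countable unions of elements of $\mathcal K$. A family $\mathbf A\colon I\to\mathcal Q$ is a partition of $A$ (into elements of $\mathcal Q$) if $\mathbf A(i)\cap\mathbf A(j)=\varnothing$ for $i\ne j$ and $\bigcup_{i\in I}\mathbf A(i)=A$ (members may be empty and $I$ may be empty); it is countable if $I$ is countable. Let $\mathfrak A$ be an HTM. A family $f\colon I\to\mathfrak A$ is summable in $\mathfrak A$ if the net $J\mapsto\sum_{i\in J}f(i)$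 over the finite subsets $J\subset I$, directed by inclusion, converges in $\mathfrak A$; its limit is denoted $\sum f$. An $\mathfrak A$-valued premeasure is a map $\mu\colon D_\mu\to\mathfrak A$ whose domain $D_\mu$ is a $\delta$-ring and such that for every $A\in D_\mu$ and every countable partition $\mathbf A$ of $A$ into elements of $D_\mu$, the family $\mu\circ\mathbf A$ is summable in $\mathfrak A$ and $\mu(A)=\sum\mu\circ\mathbf A$. The host $\sigma$-ring of a map $\mu$ is $\mathscr H[\mu]=\sigma(D_\mu)$. Maps $\mu,\nu$ are similar, $\mu\asymp\nu$, if $\mathscr H[\mu]=\mathscr H[\nu]$ and $\mu,\nu$ coincide on $D_\mu\cap D_\nu$. An $\mathfrak A$-valued measure is an $\mathfrak A$-valued premeasure $\mu$ which is an extension of every $\mathfrak A$-valued premeasure $\nu$ with $\nu\asymp\mu$. For every $\mathfrak A$-valued premeasure $\mu$ there is a unique $\mathfrak A$-valued measure similar to $\mu$; it is denoted $[\![\mu]\!]_{\mathfrak A}$. $\mathbb R_+=[0,\infty)$ with addition, order and topology induced from $\mathbb R$. $\mathfrak R=[0,\infty]$ with its usual compact Hausdorff topology, usual order, and addition extended by $x+\infty=\infty+x=\infty$. Both are HTMs; an $\mathbb R_+$-valued premeasure is also an $\mathfrak R$-valued premeasure. For $\mathfrak A\in\{\mathbb R_+,\mathfrak R\}$, $\mathcal M(\mathcal Q,\mathfrak A)$ is the set of all $\mathfrak A$-valued measures $\mu$ with $\mathscr H[\mu]=\mathcal Q$; it is an ordered monoid with the addition $\mu+\nu=[\![\mu\dotplus\nu]\!]_{\mathfrak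 A}$, where $\mu\dotplus\nu$ is the pointwise sum defined on $D_\mu\cap D_\nu$, and the order $\mu\le\nu$ iff $\mu(A)\le\nu(A)$ for all $A\in D_\mu\cap D_\nu$. For an $\mathfrak R$-valued map $\eta$, $D^f_\eta=\{A\in D_\eta:\eta(A)<\infty\}$ and $\mathfrak F\eta$ is the restriction of $\eta$ to $D^f_\eta$. $\eta$ is $\sigma$-finite if every element of $D_\eta$ is a subset of some element of $\sigma_0(D^f_\eta)$. $\mathcal M_\sigma(\mathcal Q,\mathfrak R)$ is the set of all $\sigma$-finite elements of $\mathcal M(\mathcal Q,\mathfrak R)$; it is a submonoid of $\mathcal M(\mathcal Q,\mathfrak R)$ and is endowed with the induced addition and order. An isomorphism of ordered monoids is a monoid isomorphism $f$ such that $f(x)\le f(y)$ if and only if $x\le y$. *)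

theory Defs
  imports "HOL-Analysis.Infinite_Sum" "HOL-Analysis.Sigma_Algebra" "HOL-Algebra.Group"
    "HOL-Library.Extended_Nonnegative_Real"
begin

text \<open>
  A map \<open>\<mu>\<close> with domain a set of subsets of \<open>'a\<close> is a partial function
  \<open>'a set \<rightharpoonup> 'b\<close>, its domain being \<open>dom \<mu>\<close>; equality and extension of maps are thus
  literally \<open>=\<close> and \<open>\<subseteq>\<^sub>m\<close>. A Hausdorff topological monoid is given by a
  submonoid \<open>C\<close> of a type of class \<open>{topological_comm_monoid_add, t2_space}\<close>, with the
  induced topology: \<open>{0..} :: real set\<close> for the nonnegative reals and
  \<open>UNIV :: ennreal set\<close> for \<open>[0, \<infinity>]\<close>.
\<close>

section \<open>Rings of sets\<close>

text \<open>The library's rings of sets are relative to a base set. With base set \<open>UNIV\<close> they are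
  the nonempty sets of sets closed under union and difference.\<close>

lemma ring_of_sets_UNIV_iff:
  "ring_of_sets UNIV Q \<longleftrightarrow> Q \<noteq> {} \<and> (\<forall>A\<in>Q. \<forall>B\<in>Q. A \<union> B \<in> Q \<and> A - B \<in> Q)"
proof
  assume "ring_of_sets UNIV Q"
  then show "Q \<noteq> {} \<and> (\<forall>A\<in>Q. \<forall>B\<in>Q. A \<union> B \<in> Q \<and> A - B \<in> Q)"
    by (auto simp: ring_of_sets_iff)
next
  assume *: "Q \<noteq> {} \<and> (\<forall>A\<in>Q. \<forall>B\<in>Q. A \<union> B \<in> Q \<and> A - B \<in> Q)"
  then obtain A where "A \<in> Q" by blast
  with * have "A - A \<in> Q" by blast
  with * show "ring_of_sets UNIV Q"
    by (auto simp: ring_of_sets_iff)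
qed

definition delta_ring :: "'a set set \<Rightarrow> bool" where
  "delta_ring Q \<longleftrightarrow> ring_of_sets UNIV Q \<and>
     (\<forall>F. F \<subseteq> Q \<longrightarrow> F \<noteq> {} \<longrightarrow> countable F \<longrightarrow> \<Inter>F \<in> Q)"

definition sigma_ring :: "'a set set \<Rightarrow> bool" where
  "sigma_ring Q \<longleftrightarrow> ring_of_sets UNIV Q \<and> (\<forall>F. F \<subseteq> Q \<longrightarrow> countable F \<longrightarrow> \<Union>F \<in> Q)"

definition generated_sigma_ring :: "'a set set \<Rightarrow> 'a set set" where
  "generated_sigma_ring K = \<Inter>{Q. sigma_ring Q \<and> K \<subseteq> Q}"

definition countable_unions :: "'a set set \<Rightarrow> 'a set set" where
  "countable_unions K = {\<Union>F |F. F \<subseteq> K \<and> countable F}"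


section \<open>Premeasures and measures\<close>

text \<open>Countable families are indexed by arbitrary sets of natural numbers (finite or empty ones
  included), which exhausts countable index sets up to reindexing.\<close>

definition countable_partition ::
    "'a set set \<Rightarrow> 'a set \<Rightarrow> nat set \<Rightarrow> (nat \<Rightarrow> 'a set) \<Rightarrow> bool" where
  "countable_partition Q A I P \<longleftrightarrow>
     P ` I \<subseteq> Q \<and> disjoint_family_on P I \<and> (\<Union>i\<in>I. P i) = A"

text \<open>All values, in particular the prescribed sum \<open>\<mu>(A)\<close>, lie in \<open>C\<close>, so
  \<open>has_sum\<close> in the ambient type is convergence in the induced topology of \<open>C\<close>.\<close>

definition premeasure ::
    "'b::{topological_comm_monoid_add, t2_space} set \<Rightarrow> ('a set \<rightharpoonup> 'b) \<Rightarrow> bool" where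
  "premeasure C \<mu> \<longleftrightarrow> ran \<mu> \<subseteq> C \<and> delta_ring (dom \<mu>) \<and>
     (\<forall>A\<in>dom \<mu>. \<forall>I P. countable_partition (dom \<mu>) A I P \<longrightarrow>
        ((\<lambda>i. the (\<mu> (P i))) has_sum the (\<mu> A)) I)"

definition host :: "('a set \<rightharpoonup> 'b) \<Rightarrow> 'a set set" where
  "host \<mu> = generated_sigma_ring (dom \<mu>)"

definition similar :: "('a set \<rightharpoonup> 'b) \<Rightarrow> ('a set \<rightharpoonup> 'b) \<Rightarrow> bool" where
  "similar \<mu> \<nu> \<longleftrightarrow> host \<mu> = host \<nu> \<and> (\<forall>A\<in>dom \<mu> \<inter> dom \<nu>. \<mu> A = \<nu> A)"

definition is_measure ::
    "'b::{topological_comm_monoid_add, t2_space} set \<Rightarrow> ('a set \<rightharpoonup> 'b) \<Rightarrow> bool" where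
  "is_measure C \<mu> \<longleftrightarrow> premeasure C \<mu> \<and> (\<forall>\<nu>. premeasure C \<nu> \<and> similar \<nu> \<mu> \<longrightarrow> \<nu> \<subseteq>\<^sub>m \<mu>)"

definition measure_of_pre ::
    "'b::{topological_comm_monoid_add, t2_space} set \<Rightarrow> ('a set \<rightharpoonup> 'b) \<Rightarrow> ('a set \<rightharpoonup> 'b)" where
  "measure_of_pre C \<mu> = (THE \<nu>. is_measure C \<nu> \<and> similar \<nu> \<mu>)"

definition measures_on ::
    "'a set set \<Rightarrow> 'b::{topological_comm_monoid_add, t2_space} set \<Rightarrow> ('a set \<rightharpoonup> 'b) set" where
  "measures_on Q C = {\<mu>. is_measure C \<mu> \<and> host \<mu> = Q}"


section \<open>Ordered monoids of measures\<close>

record 'm ordered_monoid = "'m monoid" +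
  ord_le :: "'m \<Rightarrow> 'm \<Rightarrow> bool"

definition ordered_monoid_iso ::
    "('m, 'x) ordered_monoid_scheme \<Rightarrow> ('n, 'y) ordered_monoid_scheme \<Rightarrow> ('m \<Rightarrow> 'n) \<Rightarrow> bool" where
  "ordered_monoid_iso G H f \<longleftrightarrow> f \<in> iso G H \<and> f \<one>\<^bsub>G\<^esub> = \<one>\<^bsub>H\<^esub> \<and>
     (\<forall>x\<in>carrier G. \<forall>y\<in>carrier G. ord_le H (f x) (f y) \<longleftrightarrow> ord_le G x y)"

definition pointwise_sum ::
    "('a set \<rightharpoonup> 'b::plus) \<Rightarrow> ('a set \<rightharpoonup> 'b) \<Rightarrow> ('a set \<rightharpoonup> 'b)" where
  "pointwise_sum \<mu> \<nu> =
     (\<lambda>A. if A \<in> dom \<mu> \<inter> dom \<nu> then Some (the (\<mu> A) + the (\<nu> A)) else None)"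

text \<open>The neutral element is the zero map on all of \<open>Q\<close>.\<close>

definition measure_monoid ::
    "'a set set \<Rightarrow> 'b::{topological_comm_monoid_add, t2_space, ord} set
      \<Rightarrow> ('a set \<rightharpoonup> 'b) ordered_monoid" where
  "measure_monoid Q C =
     \<lparr>carrier = measures_on Q C,
      mult = (\<lambda>\<mu> \<nu>. measure_of_pre C (pointwise_sum \<mu> \<nu>)),
      one = (\<lambda>A. if A \<in> Q then Some 0 else None),
      ord_le = (\<lambda>\<mu> \<nu>. \<forall>A\<in>dom \<mu> \<inter> dom \<nu>. the (\<mu> A) \<le> the (\<nu> A))\<rparr>"

definition finite_dom :: "('a set \<rightharpoonup> ennreal) \<Rightarrow> 'a set set" where
  "finite_dom \<eta> = {A \<in> dom \<eta>. the (\<eta> A) < \<infinity>}"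

text \<open>The maps \<open>enn2real\<close> and \<open>ennreal\<close> only identify \<open>[0, \<infinity>)\<close> as a
  subset of \<open>[0, \<infinity>]\<close> with \<open>{0..} :: real set\<close>.\<close>

definition finite_part :: "('a set \<rightharpoonup> ennreal) \<Rightarrow> ('a set \<rightharpoonup> real)" where
  "finite_part \<eta> = (\<lambda>A. map_option enn2real ((\<eta> |` finite_dom \<eta>) A))"

definition as_ennreal_valued :: "('a set \<rightharpoonup> real) \<Rightarrow> ('a set \<rightharpoonup> ennreal)" where
  "as_ennreal_valued \<mu> = (\<lambda>A. map_option ennreal (\<mu> A))"

definition sigma_finite_map :: "('a set \<rightharpoonup> ennreal) \<Rightarrow> bool" where
  "sigma_finite_map \<eta> \<longleftrightarrow> (\<forall>A\<in>dom \<eta>. \<exists>B\<in>countable_unions (finite_dom \<eta>). A \<subseteq> B)"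

definition sigma_finite_measure_monoid ::
    "'a set set \<Rightarrow> ('a set \<rightharpoonup> ennreal) ordered_monoid" where
  "sigma_finite_measure_monoid Q =
     (measure_monoid Q UNIV)\<lparr>carrier := {\<eta> \<in> measures_on Q UNIV. sigma_finite_map \<eta>}\<rparr>"

end

theory Submission imports Defs begin

text \<open>
  A \<open>\<delta>\<close>-ring is an ideal in the \<open>\<sigma>\<close>-ring that it generates, and the intersection of two
  \<open>\<delta>\<close>-rings generating the same \<open>\<sigma>\<close>-ring generates it too. Hence similar premeasures are
  determined by their common values, and similarity is transitive. A \<open>[0, \<infinity>]\<close>-valued
  premeasure \<open>\<mu>\<close> extends to its host \<open>\<sigma>\<close>-ring by
  \<open>A \<mapsto> sup {\<mu>(B) | B \<subseteq> A, B \<in> D\<^sub>\<mu>}\<close>, so the \<open>[0, \<infinity>]\<close>-valued measures hosted by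
  \<open>Q\<close> are exactly the premeasures with domain \<open>Q\<close>. Such an \<open>\<eta>\<close> is \<open>\<sigma>\<close>-finite iff its sets of
  finite value generate \<open>Q\<close>; then its finite part determines it, order included, and is maximal
  among the real-valued premeasures similar to it.
\<close>

subsection \<open>\<open>\<delta>\<close>-rings and the \<open>\<sigma>\<close>-rings they generate\<close>

lemma delta_ringD:
  assumes "delta_ring D"
  shows "ring_of_sets UNIV D" "F \<subseteq> D \<Longrightarrow> F \<noteq> {} \<Longrightarrow> countable F \<Longrightarrow> \<Inter>F \<in> D"
  using assms by (auto simp: delta_ring_def)

lemma delta_ring_Un: "delta_ring D \<Longrightarrow> A \<in> D \<Longrightarrow> B \<in> D \<Longrightarrow> A \<union> B \<in> D"
  and delta_ring_Diff: "delta_ring D \<Longrightarrow> A \<in> D \<Longrightarrow> B \<in> D \<Longrightarrow> A - B \<in> D"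
  and delta_ring_empty: "delta_ring D \<Longrightarrow> {} \<in> D"
  by (auto simp: delta_ring_def ring_of_sets_iff)

lemma delta_ring_Int: "delta_ring D \<Longrightarrow> A \<in> D \<Longrightarrow> B \<in> D \<Longrightarrow> A \<inter> B \<in> D"
  by (metis Diff_Diff_Int delta_ring_Diff)

text \<open>De Morgan inside \<open>B\<close>: countable intersections of the sets
  \<open>B - A\<close> yield exactly those countable unions that stay below a member of
  \<open>D\<close>.\<close>

lemma delta_ring_countable_Union:
  assumes D: "delta_ring D" and F: "F \<subseteq> D" "countable F" and B: "B \<in> D" "\<Union>F \<subseteq> B"
  shows "\<Union>F \<in> D"
proof -
  \<comment> \<open>The extra member \<open>{}\<close> contributes \<open>B\<close> itself, which
    keeps the family nonempty when \<open>F\<close> is empty and leaves the intersection within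
    \<open>B\<close> unchanged.\<close>
  have "(\<Inter>A\<in>insert {} F. B - A) \<in> D"
    using F B by (intro delta_ringD(2)[OF D]) (auto intro: delta_ring_Diff[OF D] delta_ring_empty[OF D])
  then have "B - (\<Inter>A\<in>insert {} F. B - A) \<in> D"
    using B delta_ring_Diff[OF D] by blast
  moreover have "B - (\<Inter>A\<in>insert {} F. B - A) = \<Union>F"
    using B by auto
  ultimately show ?thesis by simp
qed

lemma sigma_ring_generated: "sigma_ring (generated_sigma_ring K)"
  unfolding sigma_ring_def
proof (intro conjI allI impI)
  show "ring_of_sets UNIV (generated_sigma_ring K)"
    by (auto simp: ring_of_sets_iff generated_sigma_ring_def sigma_ring_def)
  fix F assume F: "F \<subseteq> generated_sigma_ring K" "countable F"
  show "\<Union>F \<in> generated_sigma_ring K"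
    unfolding generated_sigma_ring_def
  proof clarify
    fix Q assume Q: "sigma_ring Q" "K \<subseteq> Q"
    then have "F \<subseteq> Q" using F by (auto simp: generated_sigma_ring_def)
    then show "\<Union>F \<in> Q" using Q F by (simp add: sigma_ring_def)
  qed
qed

lemma generated_sigma_ring_superset: "K \<subseteq> generated_sigma_ring K"
  by (auto simp: generated_sigma_ring_def)

lemma generated_sigma_ring_minimal: "sigma_ring Q \<Longrightarrow> K \<subseteq> Q \<Longrightarrow> generated_sigma_ring K \<subseteq> Q"
  by (auto simp: generated_sigma_ring_def)

lemma generated_sigma_ring_idem: "sigma_ring Q \<Longrightarrow> generated_sigma_ring Q = Q"
  by (simp add: generated_sigma_ring_minimal generated_sigma_ring_superset subset_antisym)

text \<open>The dual De Morgan argument: any member \<open>B\<close> of the family serves as ambient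
  set, and the intersection is \<open>B\<close> minus a countable union.\<close>

lemma sigma_ring_imp_delta_ring:
  assumes Q: "sigma_ring Q"
  shows "delta_ring Q"
  unfolding delta_ring_def
proof (intro conjI allI impI)
  show R: "ring_of_sets UNIV Q" using Q by (simp add: sigma_ring_def)
  fix F assume F: "F \<subseteq> Q" "F \<noteq> {}" "countable F"
  then obtain B where B: "B \<in> F" by blast
  have "(\<lambda>A. B - A) ` F \<subseteq> Q" using R F B by (auto simp: ring_of_sets_iff subset_iff)
  then have "(\<Union>A\<in>F. B - A) \<in> Q"
    using Q F unfolding sigma_ring_def by (metis countable_image)
  then have "B - (\<Union>A\<in>F. B - A) \<in> Q"
    using R B F by (auto simp: ring_of_sets_iff)
  moreover have "B - (\<Union>A\<in>F. B - A) = \<Inter>F" using B by auto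
  ultimately show "\<Inter>F \<in> Q" by simp
qed

text \<open>Unions regroup after a countable decomposition is chosen for each member. For
  differences, removing \<open>\<Union>G\<close> from \<open>X\<close> removes only the traces
  \<open>X \<inter> Y\<close>; their union is bounded by \<open>X\<close>, so the rest stays in
  \<open>D\<close>.\<close>

lemma sigma_ring_countable_unions:
  assumes D: "delta_ring D"
  shows "sigma_ring (countable_unions D)"
proof -
  have U: "\<Union>G \<in> countable_unions D" if "G \<subseteq> D" "countable G" for G
    using that by (auto simp: countable_unions_def)
  have UU: "\<Union>F \<in> countable_unions D" if F: "F \<subseteq> countable_unions D" "countable F" for F
  proof -
    have "\<forall>A\<in>F. \<exists>G. A = \<Union>G \<and> G \<subseteq> D \<and> countable G"
      using F by (auto simp: countable_unions_def)
    then obtain g where g: "\<And>A. A \<in> F \<Longrightarrow> \<Union>(g A) = A \<and> g A \<subseteq> D \<and> countable (g A)"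
      by metis
    have "\<Union>(\<Union>A\<in>F. g A) \<in> countable_unions D"
      using g F by (intro U) auto
    moreover have "\<Union>(\<Union>A\<in>F. g A) = (\<Union>A\<in>F. \<Union>(g A))" by blast
    then have "\<Union>(\<Union>A\<in>F. g A) = \<Union>F" using g by simp
    ultimately show ?thesis by simp
  qed
  have Un: "A \<union> B \<in> countable_unions D" if "A \<in> countable_unions D" "B \<in> countable_unions D" for A B
    using UU[of "{A, B}"] that by simp
  have Diff: "A - B \<in> countable_unions D"
    if AB: "A \<in> countable_unions D" "B \<in> countable_unions D" for A B
  proof -
    obtain F where F: "A = \<Union>F" "F \<subseteq> D" "countable F" using AB by (auto simp: countable_unions_def)
    obtain G where G: "B = \<Union>G" "G \<subseteq> D" "countable G" using AB by (auto simp: countable_unions_def)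
    have "X - B \<in> D" if X: "X \<in> D" for X
    proof -
      have "\<Union>((\<lambda>Y. X \<inter> Y) ` G) \<in> D"
        using G X by (intro delta_ring_countable_Union[OF D, where B=X]) (auto intro: delta_ring_Int[OF D])
      then have "X - \<Union>((\<lambda>Y. X \<inter> Y) ` G) \<in> D" using X delta_ring_Diff[OF D] by blast
      moreover have "X - \<Union>((\<lambda>Y. X \<inter> Y) ` G) = X - B" using G by auto
      ultimately show ?thesis by simp
    qed
    then have "\<Union>((\<lambda>X. X - B) ` F) \<in> countable_unions D" using F by (intro U) auto
    moreover have "\<Union>((\<lambda>X. X - B) ` F) = A - B" using F by auto
    ultimately show ?thesis by simp
  qed
  have "{} \<in> countable_unions D" using U[of "{}"] by simp
  then show ?thesis
    using Un Diff UU by (auto simp: sigma_ring_def ring_of_sets_iff)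
qed

text \<open>Makes generation concrete: membership in the generated \<sigma>-ring can be used by
  picking a countable family in \<open>D\<close>.\<close>

lemma generated_sigma_ring_delta_ring:
  assumes D: "delta_ring D"
  shows "generated_sigma_ring D = countable_unions D"
proof
  have "D \<subseteq> countable_unions D"
  proof
    fix A assume "A \<in> D"
    then have "{A} \<subseteq> D \<and> countable {A} \<and> A = \<Union>{A}" by simp
    then show "A \<in> countable_unions D" unfolding countable_unions_def by blast
  qed
  then show "generated_sigma_ring D \<subseteq> countable_unions D"
    using sigma_ring_countable_unions[OF D] generated_sigma_ring_minimal by blast
  show "countable_unions D \<subseteq> generated_sigma_ring D"
    using sigma_ring_generated[of D] generated_sigma_ring_superset[of D]
    by (auto simp: countable_unions_def sigma_ring_def)
qed

text \<open>The set \<open>A\<close> is a countable union of members of \<open>D\<close>, and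
  \<open>B\<close> supplies the bound that such unions require.\<close>

lemma delta_ring_ideal:
  assumes D: "delta_ring D" and A: "A \<in> generated_sigma_ring D" and B: "A \<subseteq> B" "B \<in> D"
  shows "A \<in> D"
proof -
  obtain F where "A = \<Union>F" "F \<subseteq> D" "countable F"
    using A generated_sigma_ring_delta_ring[OF D] by (auto simp: countable_unions_def)
  then show ?thesis using delta_ring_countable_Union[OF D] B by blast
qed

text \<open>An enumerated countable cover is made disjoint. Countable additivity then reaches sets
  of the generated \<sigma>-ring that need not lie in \<open>D\<close>.\<close>

lemma countable_partition_exists:
  assumes D: "delta_ring D" and A: "A \<in> generated_sigma_ring D"
  obtains P where "countable_partition D A UNIV P"
proof -
  obtain F where F: "A = \<Union>F" "F \<subseteq> D" "countable F"
    using A generated_sigma_ring_delta_ring[OF D] by (auto simp: countable_unions_def)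
  \<comment> \<open>Inserting \<open>{}\<close> makes the enumerated set nonempty, so that its
    enumeration has exactly this range; empty members of a partition are harmless.\<close>
  define P where "P = from_nat_into (insert {} F)"
  have r: "range P = insert {} F"
    using F by (simp add: P_def)
  then have "range (disjointed P) \<subseteq> D"
    using F delta_ring_empty[OF D]
    by (intro ring_of_sets.range_disjointed_sets[OF delta_ringD(1)[OF D]]) auto
  then have "countable_partition D A UNIV (disjointed P)"
    using r F by (auto simp: countable_partition_def UN_disjointed_eq disjoint_family_disjointed)
  then show ?thesis by (rule that)
qed

lemma countable_partition_mono:
  "countable_partition D A I P \<Longrightarrow> D \<subseteq> E \<Longrightarrow> countable_partition E A I P"
  by (auto simp: countable_partition_def)

text \<open>A set \<open>B\<close> in \<open>D\<close> is cut by a partition into members of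
  \<open>E\<close>. The pieces belong to the common generated \<sigma>-ring and lie below
  \<open>B\<close>, so the ideal property puts them in \<open>D\<close> as well.\<close>

lemma delta_ring_inter:
  assumes D: "delta_ring D" and E: "delta_ring E"
    and gen: "generated_sigma_ring D = generated_sigma_ring E"
  shows "delta_ring (D \<inter> E)" "generated_sigma_ring (D \<inter> E) = generated_sigma_ring D"
proof -
  show DE: "delta_ring (D \<inter> E)"
    using D E unfolding delta_ring_def ring_of_sets_iff by simp
  have sub: "B \<in> generated_sigma_ring (D \<inter> E)" if B: "B \<in> D" for B
  proof -
    obtain P where P: "countable_partition E B UNIV P"
      using countable_partition_exists[OF E, of B] B gen generated_sigma_ring_superset by blast
    have "P i \<in> D" for i
    proof (rule delta_ring_ideal[OF D _ _ B])
      show "P i \<in> generated_sigma_ring D"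
        using P gen generated_sigma_ring_superset by (fastforce simp: countable_partition_def)
      show "P i \<subseteq> B" using P by (auto simp: countable_partition_def)
    qed
    then have "range P \<subseteq> D \<inter> E" "B = \<Union>(range P)" using P by (auto simp: countable_partition_def)
    then show ?thesis
      unfolding generated_sigma_ring_delta_ring[OF DE] countable_unions_def by blast
  qed
  show "generated_sigma_ring (D \<inter> E) = generated_sigma_ring D"
  proof
    show "generated_sigma_ring (D \<inter> E) \<subseteq> generated_sigma_ring D"
      using generated_sigma_ring_superset[of D]
      by (intro generated_sigma_ring_minimal sigma_ring_generated) auto
    show "generated_sigma_ring D \<subseteq> generated_sigma_ring (D \<inter> E)"
      using sub by (intro generated_sigma_ring_minimal sigma_ring_generated) auto
  qed
qed


subsection \<open>Premeasures and similarity\<close>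

lemma premeasure_delta_ring: "premeasure C \<mu> \<Longrightarrow> delta_ring (dom \<mu>)"
  by (simp add: premeasure_def)

lemma premeasure_has_sum:
  assumes "premeasure C \<mu>" "A \<in> dom \<mu>" "countable_partition (dom \<mu>) A I P"
  shows "((\<lambda>i. the (\<mu> (P i))) has_sum the (\<mu> A)) I"
  using assms by (simp add: premeasure_def)

text \<open>Cancellation in a + a = a would fail at \<infinity>; instead, the partition of
  \<open>{}\<close> without members makes the value an empty sum.\<close>

lemma premeasure_empty:
  assumes "premeasure C \<mu>"
  shows "\<mu> {} = Some 0"
proof -
  have "{} \<in> dom \<mu>" using assms by (simp add: premeasure_delta_ring delta_ring_empty)
  moreover have "countable_partition (dom \<mu>) {} {} (\<lambda>_. {})"
    by (simp add: countable_partition_def disjoint_family_on_def)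
  ultimately have "((\<lambda>_. the (\<mu> {})) has_sum the (\<mu> {})) ({} :: nat set)"
    using premeasure_has_sum[OF assms] by blast
  then have "the (\<mu> {}) = 0" using has_sum_empty by (rule has_sum_unique)
  with \<open>{} \<in> dom \<mu>\<close> show ?thesis by (auto simp: domIff)
qed

lemma dom_subset_host: "dom \<mu> \<subseteq> host \<mu>"
  by (simp add: host_def generated_sigma_ring_superset)

text \<open>On a partition of \<open>A\<close> into members of \<open>D\<close> both maps produce
  the same family, and limits are unique in a Hausdorff space.\<close>

lemma premeasure_eqI:
  assumes \<mu>: "premeasure C \<mu>" and \<nu>: "premeasure C' \<nu>"
    and D: "delta_ring D" "D \<subseteq> dom \<mu> \<inter> dom \<nu>" "\<And>B. B \<in> D \<Longrightarrow> \<mu> B = \<nu> B"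
    and A: "A \<in> dom \<mu> \<inter> dom \<nu>" "A \<in> generated_sigma_ring D"
  shows "\<mu> A = \<nu> A"
proof -
  obtain P where P: "countable_partition D A UNIV P"
    using countable_partition_exists[OF D(1) A(2)] .
  have "((\<lambda>i. the (\<mu> (P i))) has_sum the (\<mu> A)) UNIV"
    using P D A by (intro premeasure_has_sum[OF \<mu>]) (auto intro: countable_partition_mono)
  moreover have "((\<lambda>i. the (\<nu> (P i))) has_sum the (\<nu> A)) UNIV"
    using P D A by (intro premeasure_has_sum[OF \<nu>]) (auto intro: countable_partition_mono)
  moreover have "\<mu> (P i) = \<nu> (P i)" for i
    using P D by (auto simp: countable_partition_def)
  ultimately have "the (\<mu> A) = the (\<nu> A)" using has_sum_unique by fastforce
  then show ?thesis using A by (auto simp: domIff)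
qed

lemma similar_sym: "similar \<mu> \<nu> \<Longrightarrow> similar \<nu> \<mu>"
  by (auto simp: similar_def)

text \<open>The difficulty is a set in \<open>dom \<mu> \<inter> dom \<rho>\<close> outside
  \<open>dom \<nu>\<close>. The triple intersection of domains still generates the host, so
  agreement there propagates.\<close>

lemma similar_trans:
  assumes \<mu>: "premeasure C \<mu>" and \<nu>: "premeasure C' \<nu>" and \<rho>: "premeasure C'' \<rho>"
    and s: "similar \<mu> \<nu>" "similar \<nu> \<rho>"
  shows "similar \<mu> \<rho>"
proof -
  note d = premeasure_delta_ring[OF \<mu>] premeasure_delta_ring[OF \<nu>] premeasure_delta_ring[OF \<rho>]
  have h: "generated_sigma_ring (dom \<mu>) = generated_sigma_ring (dom \<nu>)"
    "generated_sigma_ring (dom \<nu>) = generated_sigma_ring (dom \<rho>)"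
    using s by (auto simp: similar_def host_def)
  let ?D = "dom \<mu> \<inter> (dom \<nu> \<inter> dom \<rho>)"
  have D: "delta_ring ?D" "generated_sigma_ring ?D = generated_sigma_ring (dom \<mu>)"
    using delta_ring_inter d h by metis+
  have "\<mu> A = \<rho> A" if A: "A \<in> dom \<mu> \<inter> dom \<rho>" for A
  proof (rule premeasure_eqI[OF \<mu> \<rho> D(1)])
    show "\<mu> B = \<rho> B" if "B \<in> ?D" for B using that s by (auto simp: similar_def)
    show "A \<in> generated_sigma_ring ?D"
      using A D generated_sigma_ring_superset[of "dom \<mu>"] by auto
  qed (use A in auto)
  then show ?thesis using s by (auto simp: similar_def)
qed

lemma similar_if_map_le: "\<mu> \<subseteq>\<^sub>m \<nu> \<Longrightarrow> host \<mu> = host \<nu> \<Longrightarrow> similar \<mu> \<nu>"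
  by (auto simp: similar_def map_le_def)

lemma is_measure_eqI:
  assumes "is_measure C \<mu>" "is_measure C \<nu>" "similar \<mu> \<nu>"
  shows "\<mu> = \<nu>"
  using assms map_le_antisym similar_sym unfolding is_measure_def by blast

text \<open>Resolves the definite description: two measures similar to \<open>\<mu>\<close> are
  similar to each other, hence extend each other.\<close>

lemma measure_of_pre_eq:
  assumes \<mu>: "premeasure C \<mu>" and \<nu>: "is_measure C \<nu>" "similar \<nu> \<mu>"
  shows "measure_of_pre C \<mu> = \<nu>"
  unfolding measure_of_pre_def
proof (rule the_equality)
  fix \<rho> assume \<rho>: "is_measure C \<rho> \<and> similar \<rho> \<mu>"
  then have "similar \<rho> \<nu>"
    using \<mu> \<nu> similar_trans[of C \<rho> C \<mu> C \<nu>] similar_sym unfolding is_measure_def by blast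
  then show "\<rho> = \<nu>" using \<rho> \<nu> is_measure_eqI by blast
qed (use \<nu> in simp)

lemma measure_of_pre_is_measure: "is_measure C \<mu> \<Longrightarrow> measure_of_pre C \<mu> = \<mu>"
  by (rule measure_of_pre_eq) (auto simp: is_measure_def similar_def)


subsection \<open>Measures with values in \<open>[0, \<infinity>]\<close>\<close>

text \<open>A similar premeasure has its domain inside the common host, which is already all of
  \<open>dom \<eta>\<close>.\<close>

lemma is_measure_if_sigma_ring_dom:
  assumes "premeasure C \<eta>" "sigma_ring (dom \<eta>)"
  shows "is_measure C \<eta>"
  unfolding is_measure_def
proof (intro conjI allI impI)
  fix \<nu> assume \<nu>: "premeasure C \<nu> \<and> similar \<nu> \<eta>"
  then have "dom \<nu> \<subseteq> dom \<eta>"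
    using dom_subset_host[of \<nu>] assms by (simp add: similar_def host_def generated_sigma_ring_idem)
  then show "\<nu> \<subseteq>\<^sub>m \<eta>" using \<nu> by (auto simp: map_le_def similar_def)
qed (rule assms)

lemma ennreal_premeasure_add:
  fixes \<mu> :: "'a set \<rightharpoonup> ennreal"
  assumes \<mu>: "premeasure UNIV \<mu>" and A: "A \<in> dom \<mu>" "B \<in> dom \<mu>" "A \<inter> B = {}"
  shows "the (\<mu> (A \<union> B)) = the (\<mu> A) + the (\<mu> B)"
proof -
  let ?P = "\<lambda>i::nat. if i = 0 then A else B"
  have "((\<lambda>i. the (\<mu> (?P i))) has_sum the (\<mu> (A \<union> B))) {0, 1}"
  proof (rule premeasure_has_sum[OF \<mu>])
    show "A \<union> B \<in> dom \<mu>" using A premeasure_delta_ring[OF \<mu>] delta_ring_Un by blast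
    show "countable_partition (dom \<mu>) (A \<union> B) {0, 1} ?P"
      using A by (auto simp: countable_partition_def disjoint_family_on_def)
  qed
  then have "(\<Sum>i\<in>{0, 1}. the (\<mu> (?P i))) = the (\<mu> (A \<union> B))"
    by (simp only: has_sum_finite_iff finite.intros)
  then show ?thesis by simp
qed

lemma ennreal_premeasure_mono:
  fixes \<mu> :: "'a set \<rightharpoonup> ennreal"
  assumes \<mu>: "premeasure UNIV \<mu>" and A: "A \<in> dom \<mu>" "B \<in> dom \<mu>" "A \<subseteq> B"
  shows "the (\<mu> A) \<le> the (\<mu> B)"
proof -
  have "the (\<mu> (A \<union> (B - A))) = the (\<mu> A) + the (\<mu> (B - A))"
    using A delta_ring_Diff[OF premeasure_delta_ring[OF \<mu>]]
    by (intro ennreal_premeasure_add[OF \<mu>]) auto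
  then show ?thesis using A by (simp add: Un_absorb1)
qed

text \<open>Additivity of the inner supremum \<open>m\<close> splits in two: superadditivity on
  disjoint sets bounds the partial sums by \<open>m A\<close>, and cutting inner sets along the
  partition gives the converse.\<close>

lemma ennreal_premeasure_extension:
  fixes \<mu> :: "'a set \<rightharpoonup> ennreal"
  assumes \<mu>: "premeasure UNIV \<mu>"
  obtains \<eta> where "premeasure UNIV \<eta>" "dom \<eta> = host \<mu>" "\<mu> \<subseteq>\<^sub>m \<eta>"
proof -
  let ?D = "dom \<mu>"
  note D = premeasure_delta_ring[OF \<mu>]
  define m where "m A = (SUP B\<in>{B \<in> ?D. B \<subseteq> A}. the (\<mu> B))" for A
  note mono = ennreal_premeasure_mono[OF \<mu>]
  have m_eq: "m A = the (\<mu> A)" if "A \<in> ?D" for A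
    unfolding m_def using that mono by (intro antisym SUP_least SUP_upper2) auto
  \<comment> \<open>Inner sets of disjoint \<open>A\<close> and \<open>B\<close> unite to an inner
    set of \<open>A \<union> B\<close>; the two suprema are then taken one after the other.\<close>
  have m_Un: "m A + m B \<le> m (A \<union> B)" if "A \<inter> B = {}" for A B
  proof -
    \<comment> \<open>Moving an addition through a supremum requires a nonempty index set;
      \<open>{}\<close> is always an inner set.\<close>
    have ne: "{E \<in> ?D. E \<subseteq> X} \<noteq> {}" for X
      using delta_ring_empty[OF D] by auto
    have "the (\<mu> E) + the (\<mu> F) \<le> m (A \<union> B)" if "E \<in> ?D" "F \<in> ?D" "E \<subseteq> A" "F \<subseteq> B" for E F
    proof -
      have "the (\<mu> E) + the (\<mu> F) = the (\<mu> (E \<union> F))"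
        using that \<open>A \<inter> B = {}\<close> by (intro ennreal_premeasure_add[OF \<mu>, symmetric]) auto
      also have "\<dots> \<le> m (A \<union> B)"
        unfolding m_def using that delta_ring_Un[OF D] by (intro SUP_upper) auto
      finally show ?thesis .
    qed
    then have "the (\<mu> E) + m B \<le> m (A \<union> B)" if "E \<in> ?D" "E \<subseteq> A" for E
      using that unfolding m_def[of B] ennreal_SUP_add_right[OF ne]
      by (auto intro!: SUP_least)
    then show ?thesis
      unfolding m_def[of A] ennreal_SUP_add_left[OF ne, symmetric] by (auto intro!: SUP_least)
  qed
  have m_UN: "(\<Sum>i\<in>F. m (P i)) \<le> m (\<Union>i\<in>F. P i)"
    if "finite F" "disjoint_family_on P F" for F and P :: "nat \<Rightarrow> 'a set"
    using that
  proof (induction F)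
    case (insert i F)
    then have "P i \<inter> (\<Union>i\<in>F. P i) = {}" by (auto simp: disjoint_family_on_def)
    moreover have "disjoint_family_on P F" using insert.prems by (auto simp: disjoint_family_on_def)
    ultimately show ?case
      using insert m_Un[of "P i" "\<Union>i\<in>F. P i"] by (auto intro: order_trans add_left_mono)
  qed simp
  define \<eta> where "\<eta> A = (if A \<in> host \<mu> then Some (m A) else None)" for A
  have dom: "dom \<eta> = host \<mu>" by (auto simp: \<eta>_def domIff split: if_splits)
  have "\<mu> \<subseteq>\<^sub>m \<eta>"
    using dom_subset_host[of \<mu>] m_eq by (auto simp: map_le_def \<eta>_def)
  moreover have "premeasure UNIV \<eta>"
    unfolding premeasure_def dom
  proof (intro conjI ballI allI impI)
    show "delta_ring (host \<mu>)"
      by (simp add: host_def sigma_ring_imp_delta_ring sigma_ring_generated)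
    fix A I P assume A: "A \<in> host \<mu>" and P: "countable_partition (host \<mu>) A I P"
    \<comment> \<open>In \<open>[0, \<infinity>]\<close> every family is summable, with sum the
      supremum of its finite partial sums. It remains to identify this supremum with
      \<open>m A\<close>.\<close>
    have sum: "((\<lambda>i. m (P i)) has_sum (SUP F\<in>{F. finite F \<and> F \<subseteq> I}. \<Sum>i\<in>F. m (P i))) I"
      (is "(_ has_sum ?S) _")
      by (rule nonneg_has_sum_complete) simp
    have "?S \<le> m A"
    proof (rule SUP_least)
      fix F assume F: "F \<in> {F. finite F \<and> F \<subseteq> I}"
      then have "(\<Sum>i\<in>F. m (P i)) \<le> m (\<Union>i\<in>F. P i)"
        using P by (intro m_UN) (auto simp: countable_partition_def intro: disjoint_family_on_mono)
      also have "\<dots> \<le> m A"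
      proof -
        have "(\<Union>i\<in>F. P i) \<subseteq> A" using P F unfolding countable_partition_def by blast
        then show ?thesis unfolding m_def by (intro SUP_subset_mono) auto
      qed
      finally show "(\<Sum>i\<in>F. m (P i)) \<le> m A" .
    qed
    \<comment> \<open>The pieces \<open>B \<inter> P i\<close> of an inner set \<open>B\<close> lie
      in \<open>?D\<close> by the ideal property, so additivity of \<open>\<mu>\<close> at
      \<open>B\<close> gives a sum with terms at most \<open>m (P i)\<close>.\<close>
    moreover have "m A \<le> ?S"
      unfolding m_def[of A]
    proof (rule SUP_least)
      fix B assume B: "B \<in> {B \<in> ?D. B \<subseteq> A}"
      have in_D: "B \<inter> P i \<in> ?D" if "i \<in> I" for i
      proof (rule delta_ring_ideal[OF D])
        have "B \<in> host \<mu>" "P i \<in> host \<mu>"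
          using B P that dom_subset_host[of \<mu>] by (auto simp: countable_partition_def)
        then show "B \<inter> P i \<in> generated_sigma_ring ?D"
          using delta_ring_Int[OF sigma_ring_imp_delta_ring[OF sigma_ring_generated]]
          by (metis host_def)
      qed (use B in auto)
      have "countable_partition ?D B I (\<lambda>i. B \<inter> P i)"
        unfolding countable_partition_def
      proof (intro conjI)
        show "disjoint_family_on (\<lambda>i. B \<inter> P i) I"
          using P unfolding countable_partition_def disjoint_family_on_def by blast
        show "(\<Union>i\<in>I. B \<inter> P i) = B" using B P unfolding countable_partition_def by blast
      qed (use in_D in auto)
      then have "((\<lambda>i. the (\<mu> (B \<inter> P i))) has_sum the (\<mu> B)) I"
        using B by (intro premeasure_has_sum[OF \<mu>]) auto
      then show "the (\<mu> B) \<le> ?S"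
        using sum by (rule has_sum_mono) (use in_D in \<open>auto simp: m_def intro!: SUP_upper\<close>)
    qed
    ultimately have "?S = m A" by (rule antisym)
    moreover have "\<And>i. i \<in> I \<Longrightarrow> the (\<eta> (P i)) = m (P i)" "the (\<eta> A) = m A"
      using A P by (auto simp: countable_partition_def \<eta>_def)
    ultimately show "((\<lambda>i. the (\<eta> (P i))) has_sum the (\<eta> A)) I"
      using sum by (subst has_sum_cong[where g="\<lambda>i. m (P i)"]) auto
  qed auto
  ultimately show ?thesis using that dom by blast
qed


text \<open>The extension of a measure to its whole host is similar to it, so maximality forces the
  two to be equal.\<close>

lemma ennreal_measures_on:
  assumes Q: "sigma_ring Q"
  shows "measures_on Q (UNIV :: ennreal set) = {\<eta>. premeasure UNIV \<eta> \<and> dom \<eta> = Q}"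
proof (intro subset_antisym subsetI)
  fix \<eta> assume "\<eta> \<in> measures_on Q (UNIV :: ennreal set)"
  then have \<eta>: "is_measure UNIV \<eta>" "host \<eta> = Q" by (auto simp: measures_on_def)
  then obtain \<zeta> where \<zeta>: "premeasure UNIV \<zeta>" "dom \<zeta> = Q" "\<eta> \<subseteq>\<^sub>m \<zeta>"
    using ennreal_premeasure_extension[of \<eta>] by (auto simp: is_measure_def)
  then have "host \<eta> = host \<zeta>" using Q \<eta> by (simp add: host_def generated_sigma_ring_idem)
  then have "similar \<zeta> \<eta>" using \<zeta> similar_sym similar_if_map_le by blast
  then have "\<zeta> \<subseteq>\<^sub>m \<eta>" using \<eta> \<zeta> by (simp add: is_measure_def)
  then have "\<eta> = \<zeta>" using \<zeta> map_le_antisym by blast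
  then show "\<eta> \<in> {\<eta>. premeasure UNIV \<eta> \<and> dom \<eta> = Q}" using \<zeta> by simp
next
  fix \<eta> :: "'a set \<rightharpoonup> ennreal"
  assume "\<eta> \<in> {\<eta>. premeasure UNIV \<eta> \<and> dom \<eta> = Q}"
  then show "\<eta> \<in> measures_on Q UNIV"
    using Q is_measure_if_sigma_ring_dom
    by (auto simp: measures_on_def host_def generated_sigma_ring_idem)
qed

text \<open>The order analogue of \<open>premeasure_eqI\<close>: termwise comparison along a
  partition into members of \<open>D\<close>.\<close>

lemma premeasure_le_on_sigma_ring:
  fixes \<eta> \<zeta> :: "'a set \<rightharpoonup> ennreal"
  assumes \<eta>: "premeasure UNIV \<eta>" and \<zeta>: "premeasure UNIV \<zeta>"
    and D: "delta_ring D" "D \<subseteq> dom \<eta> \<inter> dom \<zeta>" "\<And>B. B \<in> D \<Longrightarrow> the (\<eta> B) \<le> the (\<zeta> B)"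
    and A: "A \<in> dom \<eta> \<inter> dom \<zeta>" "A \<in> generated_sigma_ring D"
  shows "the (\<eta> A) \<le> the (\<zeta> A)"
proof -
  obtain P where P: "countable_partition D A UNIV P"
    using countable_partition_exists[OF D(1) A(2)] .
  have "((\<lambda>i. the (\<eta> (P i))) has_sum the (\<eta> A)) UNIV"
    using P D A by (intro premeasure_has_sum[OF \<eta>]) (auto intro: countable_partition_mono)
  moreover have "((\<lambda>i. the (\<zeta> (P i))) has_sum the (\<zeta> A)) UNIV"
    using P D A by (intro premeasure_has_sum[OF \<zeta>]) (auto intro: countable_partition_mono)
  ultimately show ?thesis
    by (rule has_sum_mono) (use P D in \<open>auto simp: countable_partition_def\<close>)
qed

section \<open>Pointwise sums of premeasures\<close>

lemma dom_pointwise_sum [simp]: "dom (pointwise_sum \<mu> \<nu>) = dom \<mu> \<inter> dom \<nu>"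
  by (auto simp: pointwise_sum_def split: if_splits)

lemma premeasure_pointwise_sum:
  fixes \<mu> \<nu> :: "'a set \<rightharpoonup> ennreal"
  assumes \<mu>: "premeasure UNIV \<mu>" and \<nu>: "premeasure UNIV \<nu>" and dom: "dom \<mu> = dom \<nu>"
  shows "premeasure UNIV (pointwise_sum \<mu> \<nu>)"
proof -
  have d: "dom (pointwise_sum \<mu> \<nu>) = dom \<nu>"
    using dom by simp
  show "premeasure UNIV (pointwise_sum \<mu> \<nu>)"
    unfolding premeasure_def d
  proof (intro conjI ballI allI impI)
    fix A I P assume A: "A \<in> dom \<nu>" and P: "countable_partition (dom \<nu>) A I P"
    have "((\<lambda>i. the (\<mu> (P i)) + the (\<nu> (P i))) has_sum (the (\<mu> A) + the (\<nu> A))) I"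
      using A P dom by (intro has_sum_add premeasure_has_sum[OF \<mu>] premeasure_has_sum[OF \<nu>]) auto
    moreover have "the (pointwise_sum \<mu> \<nu> B) = the (\<mu> B) + the (\<nu> B)" if "B \<in> dom \<nu>" for B
      using that dom by (simp add: pointwise_sum_def)
    ultimately show "((\<lambda>i. the (pointwise_sum \<mu> \<nu> (P i))) has_sum the (pointwise_sum \<mu> \<nu> A)) I"
      using A P unfolding countable_partition_def
      by (subst has_sum_cong[where g="\<lambda>i. the (\<mu> (P i)) + the (\<nu> (P i))"]) auto
  qed (use premeasure_delta_ring[OF \<nu>] in auto)
qed


subsection \<open>Finite parts\<close>

text \<open>On nonnegative reals \<open>ennreal\<close> commutes with finite sums and both preserves
  and reflects limits, so the net of partial sums may be tested on either side.\<close>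

lemma has_sum_ennreal_iff:
  assumes "\<And>i. i \<in> I \<Longrightarrow> 0 \<le> f i" "0 \<le> x"
  shows "((\<lambda>i. ennreal (f i)) has_sum ennreal x) I \<longleftrightarrow> (f has_sum x) I"
proof -
  have "((\<lambda>i. ennreal (f i)) has_sum ennreal x) I \<longleftrightarrow>
      ((\<lambda>F. ennreal (sum f F)) \<longlongrightarrow> ennreal x) (finite_subsets_at_top I)"
    unfolding has_sum_def using assms
    by (intro tendsto_cong eventually_finite_subsets_at_top_weakI sum_ennreal) auto
  also have "\<dots> \<longleftrightarrow> (f has_sum x) I"
    unfolding has_sum_def using assms
    by (intro tendsto_ennreal_iff eventually_finite_subsets_at_top_weakI sum_nonneg) auto
  finally show ?thesis .
qed

section \<open>Real-valued maps seen in \<open>[0, \<infinity>]\<close>\<close>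

lemma dom_as_ennreal_valued [simp]: "dom (as_ennreal_valued \<mu>) = dom \<mu>"
  by (auto simp: as_ennreal_valued_def)

lemma host_as_ennreal_valued [simp]: "host (as_ennreal_valued \<mu>) = host \<mu>"
  by (simp add: host_def)

lemma similar_as_ennreal_valued:
  "similar \<mu> \<nu> \<Longrightarrow> similar (as_ennreal_valued \<mu>) (as_ennreal_valued \<nu>)"
  by (simp add: similar_def) (simp add: as_ennreal_valued_def)

text \<open>Both directions serve: real-valued competitors are compared inside
  \<open>[0, \<infinity>]\<close>, and finite parts are recognised there as premeasures.\<close>

lemma premeasure_as_ennreal_valued_iff:
  assumes "ran \<mu> \<subseteq> {0..}"
  shows "premeasure UNIV (as_ennreal_valued \<mu>) \<longleftrightarrow> premeasure {0..} \<mu>"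
proof -
  have nonneg: "0 \<le> the (\<mu> A)" if "A \<in> dom \<mu>" for A
    using assms that by (auto simp: ran_def)
  have "((\<lambda>i. the (as_ennreal_valued \<mu> (P i))) has_sum the (as_ennreal_valued \<mu> A)) I \<longleftrightarrow>
      ((\<lambda>i. the (\<mu> (P i))) has_sum the (\<mu> A)) I"
    if "A \<in> dom \<mu>" "countable_partition (dom \<mu>) A I P" for A I P
  proof -
    have eq: "the (as_ennreal_valued \<mu> B) = ennreal (the (\<mu> B))" if "B \<in> dom \<mu>" for B
      using that by (auto simp: as_ennreal_valued_def)
    have P: "P i \<in> dom \<mu>" if "i \<in> I" for i
      using \<open>countable_partition (dom \<mu>) A I P\<close> that by (auto simp: countable_partition_def)
    have "((\<lambda>i. the (as_ennreal_valued \<mu> (P i))) has_sum the (as_ennreal_valued \<mu> A)) I \<longleftrightarrow>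
        ((\<lambda>i. ennreal (the (\<mu> (P i)))) has_sum ennreal (the (\<mu> A))) I"
      unfolding eq[OF that(1)] by (rule has_sum_cong) (simp add: eq P)
    also have "\<dots> \<longleftrightarrow> ((\<lambda>i. the (\<mu> (P i))) has_sum the (\<mu> A)) I"
      using nonneg P that by (intro has_sum_ennreal_iff) auto
    finally show ?thesis .
  qed
  then show ?thesis using assms by (auto simp: premeasure_def)
qed

lemma premeasure_restrict:
  assumes \<mu>: "premeasure C \<mu>" and D: "delta_ring D" "D \<subseteq> dom \<mu>"
  shows "premeasure C (\<mu> |` D)"
proof -
  have dom: "dom (\<mu> |` D) = D" using D by auto
  have "((\<lambda>i. the ((\<mu> |` D) (P i))) has_sum the ((\<mu> |` D) A)) I"
    if "A \<in> D" and P: "countable_partition D A I P" for A I P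
  proof -
    have "((\<lambda>i. the (\<mu> (P i))) has_sum the (\<mu> A)) I"
      using that D by (intro premeasure_has_sum[OF \<mu>]) (auto intro: countable_partition_mono)
    moreover have "P i \<in> D" if "i \<in> I" for i
      using that P by (auto simp: countable_partition_def)
    ultimately show ?thesis using \<open>A \<in> D\<close> by (subst has_sum_cong[where g="\<lambda>i. the (\<mu> (P i))"]) auto
  qed
  moreover have "ran (\<mu> |` D) \<subseteq> C"
    using \<mu> by (auto simp: premeasure_def ran_def restrict_map_def split: if_splits)
  ultimately show ?thesis using D dom by (simp add: premeasure_def)
qed

section \<open>Sets of finite value and \<sigma>-finiteness\<close>

lemma finite_dom_subset: "finite_dom \<eta> \<subseteq> dom \<eta>"
  by (auto simp: finite_dom_def)

lemma finite_dom_ideal: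
  assumes \<eta>: "premeasure UNIV \<eta>" and "B \<in> finite_dom \<eta>" "A \<in> dom \<eta>" "A \<subseteq> B"
  shows "A \<in> finite_dom \<eta>"
  using ennreal_premeasure_mono[OF \<eta>, of A B] assms by (auto simp: finite_dom_def)

text \<open>Monotonicity handles differences and intersections, which lie below a set of finite
  value; unions rest on additivity along \<open>A \<union> (B - A)\<close>.\<close>

lemma delta_ring_finite_dom:
  assumes \<eta>: "premeasure UNIV \<eta>"
  shows "delta_ring (finite_dom \<eta>)"
  unfolding delta_ring_def ring_of_sets_iff
proof (intro conjI ballI allI impI)
  note D = premeasure_delta_ring[OF \<eta>]
  show "{} \<in> finite_dom \<eta>"
    using premeasure_empty[OF \<eta>] by (auto simp: finite_dom_def)
  show Diff: "A - B \<in> finite_dom \<eta>" if "A \<in> finite_dom \<eta>" "B \<in> finite_dom \<eta>" for A B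
    using that delta_ring_Diff[OF D] finite_dom_subset[of \<eta>]
    by (intro finite_dom_ideal[OF \<eta> that(1)]) blast+
  show "A \<union> B \<in> finite_dom \<eta>" if AB: "A \<in> finite_dom \<eta>" "B \<in> finite_dom \<eta>" for A B
  proof -
    have "the (\<eta> (A \<union> (B - A))) = the (\<eta> A) + the (\<eta> (B - A))"
      using AB Diff finite_dom_subset[of \<eta>] by (intro ennreal_premeasure_add[OF \<eta>]) blast+
    moreover have "A \<union> B \<in> dom \<eta>" using AB delta_ring_Un[OF D] finite_dom_subset[of \<eta>] by blast
    ultimately show ?thesis using AB Diff[of B A] by (simp add: finite_dom_def)
  qed
  show "\<Inter>F \<in> finite_dom \<eta>" if F: "F \<subseteq> finite_dom \<eta>" "F \<noteq> {}" "countable F" for F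
  proof -
    obtain B where B: "B \<in> F" "B \<in> finite_dom \<eta>" using F by blast
    have "\<Inter>F \<in> dom \<eta>"
      using F finite_dom_subset[of \<eta>] by (intro delta_ringD(2)[OF D]) auto
    then show ?thesis using B(1) by (intro finite_dom_ideal[OF \<eta> B(2)]) auto
  qed
qed simp

text \<open>Covering turns into generation: if sets \<open>X\<close> of finite value cover
  \<open>A\<close>, the traces \<open>A \<inter> X\<close> again have finite value and their union
  is \<open>A\<close>.\<close>

lemma sigma_finite_map_iff:
  assumes \<eta>: "premeasure UNIV \<eta>" and Q: "sigma_ring (dom \<eta>)"
  shows "sigma_finite_map \<eta> \<longleftrightarrow> generated_sigma_ring (finite_dom \<eta>) = dom \<eta>"
proof -
  note gen = generated_sigma_ring_delta_ring[OF delta_ring_finite_dom[OF \<eta>]]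
  have sub: "generated_sigma_ring (finite_dom \<eta>) \<subseteq> dom \<eta>"
    using Q finite_dom_subset[of \<eta>] by (rule generated_sigma_ring_minimal)
  have "A \<in> countable_unions (finite_dom \<eta>)"
    if A: "A \<in> dom \<eta>" "A \<subseteq> B" and B: "B \<in> countable_unions (finite_dom \<eta>)" for A B
  proof -
    obtain F where F: "B = \<Union>F" "F \<subseteq> finite_dom \<eta>" "countable F"
      using B by (auto simp: countable_unions_def)
    have "A \<inter> X \<in> finite_dom \<eta>" if "X \<in> F" for X
    proof (rule finite_dom_ideal[OF \<eta>])
      show X: "X \<in> finite_dom \<eta>" using that F by blast
      then show "A \<inter> X \<in> dom \<eta>"
        using A(1) finite_dom_subset[of \<eta>]
        by (intro delta_ring_Int[OF premeasure_delta_ring[OF \<eta>]]) auto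
    qed simp
    then have "(\<lambda>X. A \<inter> X) ` F \<subseteq> finite_dom \<eta>" "countable ((\<lambda>X. A \<inter> X) ` F)"
      "A = \<Union>((\<lambda>X. A \<inter> X) ` F)"
      using F A by auto
    then show ?thesis unfolding countable_unions_def by blast
  qed
  then show ?thesis
    using sub unfolding sigma_finite_map_def gen by blast
qed

section \<open>Finite parts as maps\<close>

lemma finite_part_apply:
  "A \<in> finite_dom \<eta> \<Longrightarrow> finite_part \<eta> A = Some (enn2real (the (\<eta> A)))"
  by (auto simp: finite_part_def finite_dom_def)

lemma dom_finite_part [simp]: "dom (finite_part \<eta>) = finite_dom \<eta>"
  by (auto simp: finite_part_def finite_dom_def restrict_map_def split: if_splits)

text \<open>On finite values \<open>ennreal\<close> undoes \<open>enn2real\<close>, so questions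
  about the finite part become questions about a restriction of \<open>\<eta>\<close>.\<close>

lemma as_ennreal_valued_finite_part:
  "as_ennreal_valued (finite_part \<eta>) = \<eta> |` finite_dom \<eta>"
proof
  fix A show "as_ennreal_valued (finite_part \<eta>) A = (\<eta> |` finite_dom \<eta>) A"
    by (cases "A \<in> finite_dom \<eta>") (auto simp: as_ennreal_valued_def finite_part_def finite_dom_def)
qed

lemma finite_dom_pointwise_sum:
  "finite_dom (pointwise_sum \<eta> \<zeta>) = finite_dom \<eta> \<inter> finite_dom \<zeta>"
  by (auto simp: finite_dom_def pointwise_sum_def split: if_splits)

text \<open>A sum in \<open>[0, \<infinity>]\<close> is finite exactly when both summands are, so
  the domains agree. This is the source of additivity of the isomorphism.\<close>

lemma finite_part_pointwise_sum:
  "finite_part (pointwise_sum \<eta> \<zeta>) = pointwise_sum (finite_part \<eta>) (finite_part \<zeta>)"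
proof
  fix A
  show "finite_part (pointwise_sum \<eta> \<zeta>) A = pointwise_sum (finite_part \<eta>) (finite_part \<zeta>) A"
  proof (cases "A \<in> finite_dom \<eta> \<inter> finite_dom \<zeta>")
    case True
    then have "finite_part (pointwise_sum \<eta> \<zeta>) A = Some (enn2real (the (\<eta> A) + the (\<zeta> A)))"
      by (subst finite_part_apply)
        (auto simp: finite_dom_pointwise_sum pointwise_sum_def finite_dom_def)
    \<comment> \<open>Since \<open>enn2real\<close> sends \<infinity> to 0, it is additive only on
      finite values; real representatives are therefore chosen first.\<close>
    also have "\<dots> = Some (enn2real (the (\<eta> A)) + enn2real (the (\<zeta> A)))"
    proof -
      have "the (\<eta> A) < \<infinity>" "the (\<zeta> A) < \<infinity>" using True by (auto simp: finite_dom_def)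
      then obtain x y where "the (\<eta> A) = ennreal x" "0 \<le> x" "the (\<zeta> A) = ennreal y" "0 \<le> y"
        by (metis ennreal_enn2real enn2real_nonneg infinity_ennreal_def)
      then show ?thesis by (simp del: ennreal_plus add: ennreal_plus[symmetric])
    qed
    finally show ?thesis using True by (simp add: pointwise_sum_def finite_part_apply)
  next
    case False
    then have "A \<notin> dom (finite_part (pointwise_sum \<eta> \<zeta>))"
      by (simp add: finite_dom_pointwise_sum)
    moreover have "A \<notin> dom (pointwise_sum (finite_part \<eta>) (finite_part \<zeta>))"
      using False by simp
    ultimately show ?thesis by (simp only: domIff not_not)
  qed
qed

section \<open>The correspondence between \<sigma>-finite and real-valued measures\<close>

lemma carrier_sigma_finite_measure_monoid:
  assumes Q: "sigma_ring Q"
  shows "\<eta> \<in> carrier (sigma_finite_measure_monoid Q) \<longleftrightarrow>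
    premeasure UNIV \<eta> \<and> dom \<eta> = Q \<and> generated_sigma_ring (finite_dom \<eta>) = Q"
  using Q sigma_finite_map_iff[of \<eta>]
  by (auto simp: sigma_finite_measure_monoid_def ennreal_measures_on)

text \<open>The point is maximality. A real-valued competitor agrees with \<open>\<eta>\<close> on
  its own domain, and since its values are finite, that domain lies in
  \<open>finite_dom \<eta>\<close>.\<close>

lemma finite_part_in_measures_on:
  assumes \<eta>: "premeasure UNIV \<eta>" and dom: "generated_sigma_ring (finite_dom \<eta>) = dom \<eta>"
  shows "finite_part \<eta> \<in> measures_on (dom \<eta>) {0..}"
proof -
  let ?\<eta> = "\<eta> |` finite_dom \<eta>"
  have \<eta>': "premeasure UNIV ?\<eta>"
    using \<eta> delta_ring_finite_dom[OF \<eta>] finite_dom_subset by (rule premeasure_restrict)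
  have "sigma_ring (dom \<eta>)" using dom sigma_ring_generated by metis
  then have sim: "similar ?\<eta> \<eta>"
    using dom finite_dom_subset[of \<eta>]
    by (intro similar_if_map_le)
      (auto simp: host_def generated_sigma_ring_idem map_le_def inf_absorb2)
  have "ran (finite_part \<eta>) \<subseteq> {0..}"
    by (auto simp: finite_part_def ran_def)
  then have pre: "premeasure {0..} (finite_part \<eta>)"
    using \<eta>' by (simp add: premeasure_as_ennreal_valued_iff[symmetric] as_ennreal_valued_finite_part)
  have "\<nu> \<subseteq>\<^sub>m finite_part \<eta>" if \<nu>: "premeasure {0..} \<nu>" "similar \<nu> (finite_part \<eta>)" for \<nu>
    unfolding map_le_def
  proof
    fix A assume A: "A \<in> dom \<nu>"
    have ran: "ran \<nu> \<subseteq> {0..}" using \<nu> by (simp add: premeasure_def)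
    then have "premeasure UNIV (as_ennreal_valued \<nu>)"
      using \<nu> by (simp add: premeasure_as_ennreal_valued_iff)
    moreover have "similar (as_ennreal_valued \<nu>) ?\<eta>"
      using similar_as_ennreal_valued[OF \<nu>(2)] by (simp add: as_ennreal_valued_finite_part)
    \<comment> \<open>Transitivity through the restriction \<open>?\<eta>\<close> extends the
      agreement from sets of finite value to every set on which both maps are defined.\<close>
    ultimately have "similar (as_ennreal_valued \<nu>) \<eta>"
      using \<eta> \<eta>' sim similar_trans by blast
    moreover have "A \<in> dom \<eta>"
      using A \<nu> dom dom_subset_host[of \<nu>] by (auto simp: similar_def host_def)
    ultimately have "\<eta> A = as_ennreal_valued \<nu> A" using A by (simp add: similar_def)
    moreover obtain r where "\<nu> A = Some r" "0 \<le> r" using A ran by (auto simp: ran_def)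
    ultimately show "\<nu> A = finite_part \<eta> A"
      by (subst finite_part_apply) (auto simp: as_ennreal_valued_def finite_dom_def)
  qed
  then show ?thesis
    using pre dom by (auto simp: measures_on_def is_measure_def host_def)
qed

text \<open>The measure is the extension \<open>\<eta>\<close> of \<open>\<mu>\<close> to
  \<open>Q\<close>. Its sets of finite value include \<open>dom \<mu>\<close> and so generate
  \<open>Q\<close>; its finite part is a real-valued measure extending \<open>\<mu>\<close>, and
  similar measures coincide.\<close>

lemma measure_of_pre_as_ennreal_valued:
  assumes \<mu>: "\<mu> \<in> measures_on Q {0..}"
  shows "measure_of_pre UNIV (as_ennreal_valued \<mu>) \<in> carrier (sigma_finite_measure_monoid Q)"
    "finite_part (measure_of_pre UNIV (as_ennreal_valued \<mu>)) = \<mu>"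
proof -
  have \<mu>: "is_measure {0..} \<mu>" and host: "host \<mu> = Q" using assms by (auto simp: measures_on_def)
  then have Q: "sigma_ring Q" using sigma_ring_generated[of "dom \<mu>"] by (simp add: host_def)
  have ran: "ran \<mu> \<subseteq> {0..}" using \<mu> by (simp add: is_measure_def premeasure_def)
  have \<mu>': "premeasure UNIV (as_ennreal_valued \<mu>)"
    using \<mu> ran by (simp add: premeasure_as_ennreal_valued_iff is_measure_def)
  obtain \<eta> where \<eta>: "premeasure UNIV \<eta>" "dom \<eta> = Q" and le: "as_ennreal_valued \<mu> \<subseteq>\<^sub>m \<eta>"
    using ennreal_premeasure_extension[OF \<mu>'] host by auto
  have val: "\<eta> A = Some (ennreal (the (\<mu> A)))" if "A \<in> dom \<mu>" for A
  proof -
    have "\<eta> A = as_ennreal_valued \<mu> A" using le that by (simp add: map_le_def)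
    then show ?thesis using that by (auto simp: as_ennreal_valued_def)
  qed
  have sub: "dom \<mu> \<subseteq> finite_dom \<eta>"
  proof
    fix A assume "A \<in> dom \<mu>"
    from val[OF this] show "A \<in> finite_dom \<eta>" by (simp add: finite_dom_def dom_def)
  qed
  have gen: "generated_sigma_ring (finite_dom \<eta>) = Q"
  proof
    show "generated_sigma_ring (finite_dom \<eta>) \<subseteq> Q"
      using Q finite_dom_subset[of \<eta>] \<eta> by (intro generated_sigma_ring_minimal) auto
    show "Q \<subseteq> generated_sigma_ring (finite_dom \<eta>)"
      unfolding host[symmetric] host_def using sub generated_sigma_ring_superset[of "finite_dom \<eta>"]
      by (intro generated_sigma_ring_minimal sigma_ring_generated) blast
  qed
  have "similar \<eta> (as_ennreal_valued \<mu>)"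
    using le \<eta> Q host
    by (intro similar_sym[OF similar_if_map_le]) (simp_all add: host_def[of \<eta>] generated_sigma_ring_idem)
  then have eq: "measure_of_pre UNIV (as_ennreal_valued \<mu>) = \<eta>"
    using \<eta> Q by (intro measure_of_pre_eq[OF \<mu>'] is_measure_if_sigma_ring_dom) auto
  show "measure_of_pre UNIV (as_ennreal_valued \<mu>) \<in> carrier (sigma_finite_measure_monoid Q)"
    using eq \<eta> gen carrier_sigma_finite_measure_monoid[OF Q] by simp
  have f: "finite_part \<eta> \<in> measures_on Q {0..}"
    using finite_part_in_measures_on[OF \<eta>(1)] gen \<eta> by simp
  have "\<mu> \<subseteq>\<^sub>m finite_part \<eta>"
    unfolding map_le_def
  proof
    fix A assume A: "A \<in> dom \<mu>"
    moreover from A ran have "0 \<le> the (\<mu> A)" by (auto simp: ran_def)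
    ultimately show "\<mu> A = finite_part \<eta> A" using sub val[OF A] by (auto simp: finite_part_apply)
  qed
  then have "similar \<mu> (finite_part \<eta>)"
    using host f by (intro similar_if_map_le) (auto simp: measures_on_def)
  then show "finite_part (measure_of_pre UNIV (as_ennreal_valued \<mu>)) = \<mu>"
    using eq \<mu> f is_measure_eqI[of "{0..}" \<mu> "finite_part \<eta>"] by (auto simp: measures_on_def)
qed

section \<open>The isomorphism of ordered monoids and its inverse\<close>

theorem theorem8p17:
  fixes Q :: "'a set set"
    and f :: "('a set \<rightharpoonup> ennreal) \<Rightarrow> ('a set \<rightharpoonup> real)"
  assumes "sigma_ring Q"
    and "\<forall>\<eta>\<in>carrier (sigma_finite_measure_monoid Q). f \<eta> = finite_part \<eta>"
  shows "ordered_monoid_iso (sigma_finite_measure_monoid Q) (measure_monoid Q {0..}) f \<and>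
    (\<forall>\<mu>\<in>measures_on Q {0..}.
       inv_into (carrier (sigma_finite_measure_monoid Q)) f \<mu> =
         measure_of_pre UNIV (as_ennreal_valued \<mu>))"
proof -
  let ?G = "sigma_finite_measure_monoid Q" and ?H = "measure_monoid Q ({0..} :: real set)"
  note carrier = carrier_sigma_finite_measure_monoid[OF assms(1)]
  have f: "f \<eta> = finite_part \<eta>" if "\<eta> \<in> carrier ?G" for \<eta>
    using that assms(2) by blast
  have carrier_H: "carrier ?H = measures_on Q {0..}" by (simp add: measure_monoid_def)
  have mult_G: "\<eta> \<otimes>\<^bsub>?G\<^esub> \<zeta> = measure_of_pre UNIV (pointwise_sum \<eta> \<zeta>)" for \<eta> \<zeta>
    by (simp add: sigma_finite_measure_monoid_def measure_monoid_def)
  have mult_H: "\<mu> \<otimes>\<^bsub>?H\<^esub> \<nu> = measure_of_pre {0..} (pointwise_sum \<mu> \<nu>)" for \<mu> \<nu>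
    by (simp add: measure_monoid_def)
  have one_G: "\<one>\<^bsub>?G\<^esub> = (\<lambda>A. if A \<in> Q then Some 0 else None)"
    by (simp add: sigma_finite_measure_monoid_def measure_monoid_def)
  have one_H: "\<one>\<^bsub>?H\<^esub> = (\<lambda>A. if A \<in> Q then Some 0 else None)"
    by (simp add: measure_monoid_def)
  have le_G: "ord_le ?G \<eta> \<zeta> \<longleftrightarrow> (\<forall>A\<in>dom \<eta> \<inter> dom \<zeta>. the (\<eta> A) \<le> the (\<zeta> A))" for \<eta> \<zeta>
    by (simp add: sigma_finite_measure_monoid_def measure_monoid_def)
  have le_H: "ord_le ?H \<mu> \<nu> \<longleftrightarrow> (\<forall>A\<in>dom \<mu> \<inter> dom \<nu>. the (\<mu> A) \<le> the (\<nu> A))" for \<mu> \<nu>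
    by (simp add: measure_monoid_def)

  have fin: "finite_part \<eta> \<in> measures_on Q {0..}" if "\<eta> \<in> carrier ?G" for \<eta>
    using that carrier finite_part_in_measures_on by metis
  \<comment> \<open>The common sets of finite value still generate \<open>Q\<close>; they are the
    test sets for comparing two measures and the finite domain of their sum.\<close>
  have inter: "delta_ring (finite_dom \<eta> \<inter> finite_dom \<zeta>)"
    "generated_sigma_ring (finite_dom \<eta> \<inter> finite_dom \<zeta>) = Q"
    if "\<eta> \<in> carrier ?G" "\<zeta> \<in> carrier ?G" for \<eta> \<zeta>
    using that delta_ring_inter[of "finite_dom \<eta>" "finite_dom \<zeta>"]
    by (auto simp: carrier delta_ring_finite_dom)

  \<comment> \<open>Comparing finite parts means comparing on the common sets of finite value;
    partitions into such sets carry the inequality to all of \<open>Q\<close>.\<close>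
  have order: "ord_le ?H (f \<eta>) (f \<zeta>) \<longleftrightarrow> ord_le ?G \<eta> \<zeta>"
    if \<eta>: "\<eta> \<in> carrier ?G" and \<zeta>: "\<zeta> \<in> carrier ?G" for \<eta> \<zeta>
  proof -
    let ?D = "finite_dom \<eta> \<inter> finite_dom \<zeta>"
    have "ord_le ?H (f \<eta>) (f \<zeta>) \<longleftrightarrow> (\<forall>A\<in>?D. the (\<eta> A) \<le> the (\<zeta> A))"
    proof -
      have "the (finite_part \<eta> A) \<le> the (finite_part \<zeta> A) \<longleftrightarrow> the (\<eta> A) \<le> the (\<zeta> A)"
        if A: "A \<in> ?D" for A
      proof -
        have "the (\<eta> A) < \<infinity>" "the (\<zeta> A) < \<infinity>" using A by (auto simp: finite_dom_def)
        \<comment> \<open>Faithful comparison through \<open>enn2real\<close> needs both values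
          finite, as \<infinity> would become 0.\<close>
        then have "enn2real (the (\<eta> A)) \<le> enn2real (the (\<zeta> A)) \<longleftrightarrow> the (\<eta> A) \<le> the (\<zeta> A)"
          by (metis enn2real_mono enn2real_nonneg ennreal_enn2real ennreal_le_iff infinity_ennreal_def)
        then show ?thesis using A by (simp add: finite_part_apply)
      qed
      then show ?thesis using f \<eta> \<zeta> by (auto simp: le_H)
    qed
    also have "\<dots> \<longleftrightarrow> ord_le ?G \<eta> \<zeta>"
    proof
      assume *: "\<forall>A\<in>?D. the (\<eta> A) \<le> the (\<zeta> A)"
      show "ord_le ?G \<eta> \<zeta>"
        unfolding le_G
      proof
        fix A assume A: "A \<in> dom \<eta> \<inter> dom \<zeta>"
        then have "A \<in> generated_sigma_ring ?D" using inter(2)[OF \<eta> \<zeta>] \<eta> by (simp add: carrier)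
        moreover have "?D \<subseteq> dom \<eta> \<inter> dom \<zeta>"
          using finite_dom_subset[of \<eta>] finite_dom_subset[of \<zeta>] by blast
        moreover have "premeasure UNIV \<eta>" "premeasure UNIV \<zeta>" using \<eta> \<zeta> carrier by blast+
        ultimately show "the (\<eta> A) \<le> the (\<zeta> A)"
          using * A inter(1)[OF \<eta> \<zeta>] premeasure_le_on_sigma_ring by blast
      qed
    qed (use finite_dom_subset[of \<eta>] finite_dom_subset[of \<zeta>] in \<open>auto simp: le_G\<close>)
    finally show ?thesis .
  qed

  \<comment> \<open>Equal images are comparable in both directions, so the reflected order gives two
    inequalities on the common domain \<open>Q\<close>.\<close>
  have inj: "inj_on f (carrier ?G)"
  proof
    fix \<eta> \<zeta> assume \<eta>: "\<eta> \<in> carrier ?G" and \<zeta>: "\<zeta> \<in> carrier ?G" and eq: "f \<eta> = f \<zeta>"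
    have "ord_le ?H (f \<eta>) (f \<eta>)" by (simp add: le_H)
    then have "ord_le ?G \<eta> \<zeta>" "ord_le ?G \<zeta> \<eta>" using order \<eta> \<zeta> eq by metis+
    moreover have "dom \<eta> = Q" "dom \<zeta> = Q" using \<eta> \<zeta> by (auto simp: carrier)
    ultimately have "the (\<eta> A) = the (\<zeta> A)" if "A \<in> Q" for A
      using that by (auto simp: le_G intro: antisym)
    with \<open>dom \<eta> = Q\<close> \<open>dom \<zeta> = Q\<close> show "\<eta> = \<zeta>"
      by (intro ext) (metis domIff option.expand)
  qed
  \<comment> \<open>A right inverse of \<open>f\<close>: it yields surjectivity and, together with
    injectivity, the formula for the inverse.\<close>
  have inv: "measure_of_pre UNIV (as_ennreal_valued \<mu>) \<in> carrier ?G"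
    "f (measure_of_pre UNIV (as_ennreal_valued \<mu>)) = \<mu>" if "\<mu> \<in> measures_on Q {0..}" for \<mu>
    using measure_of_pre_as_ennreal_valued[OF that] f by auto
  have bij: "bij_betw f (carrier ?G) (carrier ?H)"
    unfolding bij_betw_def carrier_H
  proof (intro conjI inj subset_antisym subsetI)
    fix \<mu> assume "\<mu> \<in> measures_on Q ({0..} :: real set)"
    then show "\<mu> \<in> f ` carrier ?G" using inv by (metis imageI)
  qed (use f fin in auto)

  \<comment> \<open>The pointwise sum is already a measure on all of \<open>Q\<close>, and its
    finite part is a measure too, so \<open>measure_of_pre\<close> acts as the identity on both
    sides.\<close>
  have mult: "f (\<eta> \<otimes>\<^bsub>?G\<^esub> \<zeta>) = f \<eta> \<otimes>\<^bsub>?H\<^esub> f \<zeta>"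
    if \<eta>: "\<eta> \<in> carrier ?G" and \<zeta>: "\<zeta> \<in> carrier ?G" for \<eta> \<zeta>
  proof -
    let ?s = "pointwise_sum \<eta> \<zeta>"
    have s: "premeasure UNIV ?s" "dom ?s = Q"
      using premeasure_pointwise_sum[of \<eta> \<zeta>] \<eta> \<zeta> by (auto simp: carrier)
    then have "?s \<in> carrier ?G"
      using inter[OF \<eta> \<zeta>] by (simp add: carrier finite_dom_pointwise_sum)
    moreover have "measure_of_pre UNIV ?s = ?s"
      using s assms(1) by (intro measure_of_pre_is_measure is_measure_if_sigma_ring_dom) auto
    moreover have "measure_of_pre {0..} (finite_part ?s) = finite_part ?s"
      using fin[OF \<open>?s \<in> carrier ?G\<close>] by (intro measure_of_pre_is_measure) (simp add: measures_on_def)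
    ultimately show ?thesis
      using f \<eta> \<zeta> by (simp add: mult_G mult_H finite_part_pointwise_sum)
  qed

  have one: "f \<one>\<^bsub>?G\<^esub> = \<one>\<^bsub>?H\<^esub>"
  proof -
    have dom: "dom \<one>\<^bsub>?G\<^esub> = Q" by (auto simp: one_G split: if_splits)
    \<comment> \<open>The zero map takes only finite values, so passing to the finite part keeps the
      domain \<open>Q\<close> and merely turns the extended 0 into the real 0.\<close>
    have fd: "finite_dom \<one>\<^bsub>?G\<^esub> = Q" by (auto simp: one_G finite_dom_def split: if_splits)
    have "premeasure UNIV \<one>\<^bsub>?G\<^esub>"
      unfolding premeasure_def dom
    proof (intro conjI ballI allI impI)
      fix A I P assume "A \<in> Q" and P: "countable_partition Q A I P"
      moreover have "P i \<in> Q" if "i \<in> I" for i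
        using that P by (auto simp: countable_partition_def)
      ultimately show "((\<lambda>i. the (\<one>\<^bsub>?G\<^esub> (P i))) has_sum the (\<one>\<^bsub>?G\<^esub> A)) I"
        by (subst has_sum_cong[where g="\<lambda>_. 0"]) (auto simp: one_G)
    qed (use assms(1) sigma_ring_imp_delta_ring in auto)
    then have "\<one>\<^bsub>?G\<^esub> \<in> carrier ?G"
      using dom fd assms(1) by (simp add: carrier generated_sigma_ring_idem)
    then have "f \<one>\<^bsub>?G\<^esub> = finite_part \<one>\<^bsub>?G\<^esub>" by (rule f)
    also have "\<dots> = \<one>\<^bsub>?H\<^esub>"
      unfolding finite_part_def fd by (auto simp: one_G one_H restrict_map_def)
    finally show ?thesis .
  qed

  have "f \<in> hom ?G ?H"
    using mult bij by (intro homI) (auto simp: bij_betw_def)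
  then have "ordered_monoid_iso ?G ?H f"
    using bij one order by (auto simp: ordered_monoid_iso_def iso_def)
  moreover have "inv_into (carrier ?G) f \<mu> = measure_of_pre UNIV (as_ennreal_valued \<mu>)"
    if "\<mu> \<in> measures_on Q {0..}" for \<mu>
    using inv_into_f_f[OF inj inv(1)[OF that]] inv(2)[OF that] by simp
  ultimately show ?thesis by blast
qed

end
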